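(* Let $n\ge 1$ and $N\ge 2$ be integers and $T>0$ a real number. Let $\beta_1$ be the second largest eigenvalue of the transition matrix $P$ of the Gibbs sampler for the one-dimensional Ising model with $N$ states on $n$ sites at temperature $T$. Then $$\beta_1 < 1-\frac{N}{n^{2}}\cdot\frac{e^{-4/T}}{1+(N-1)e^{-4/T}}.$$
   Context: Let $c^{(1)},\dots,c^{(N)}$ be $N$ distinct states (colors) and let $\chi=\{c^{(1)},\dots,c^{(N)}\}^n$. The one-dimensional Ising model with $N$ states on $n$ sites at temperature $T>0$ is the probability measure on $\chi$ given by $$\pi(x)=\frac{1}{Z_T}\exp\Big\{\frac1T\sum_{k=1}^{n-1}\big(\mathbf 1_{\{x_k=x_{k+1}\}}-\mathbf 1_{\{x_k\ne x_{k+1}\}}\big)\Big\},\qquad x=(x_1,\dots,x_n)\in\chi,$$ where $Z_T=\sum_{x\in\chi}\exp\{\frac1T\sum_{k=1}^{n-1}(\mathbf 1_{\{x_k=x_{k+1}\}}-\mathbf 1_{\{x_k\ne x_{k+1}\}})\}$ is the normalizing constant (an empty sum is $0$). For $x\in\chi$, a site $i\in\{1,\dots,n\}$ and a color $y_i$, set $$\pi(y_i\mid x)=\frac{\pi(x_1,\dots,x_{i-1},y_i,x_{i+1},\dots,x_n)}{\sum_{l=1}^{N}\pi(x_1,\dots,x_{i-1},c^{(l)},x_{i+1},\dots,x_n)}.$$ The Gibbs sampler chooses a coordinate uniformly at random and updates it according to its conditional probability given the other coordinates. Its transition matrix $P$ on $\chi$ is: $P(x,y)=\frac1n\,\pi(y_i\mid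 x)$ if $x_i\neq y_i$ and $x_j=y_j$ for all $j\ne i$ (for some site $i$); $P(x,x)=1-\frac1n\sum_{i=1}^n\sum_{y_i\neq x_i}\pi(y_i\mid x)$, where the inner sum is over colors $y_i$ different from $x_i$; and $P(x,y)=0$ otherwise. The matrix $P$ is irreducible and reversible with respect to $\pi$, so its eigenvalues are real. Counted with multiplicity they are written $1=\beta_0>\beta_1\ge\beta_2\ge\cdots\ge\beta_{|\chi|-1}>-1$. *)

theory Defs
  imports
    "HOL-Library.FuncSet"
    "HOL-Library.Countable_Set"
    "Jordan_Normal_Form.Char_Poly"
begin

text \<open>Sites are \<open>{1..n}\<close>, and \<open>C\<close> is the set of colors, so \<open>N = card C\<close>.\<close>

definition configs :: "'c set \<Rightarrow> nat \<Rightarrow> (nat \<Rightarrow> 'c) set" where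
  "configs C n = {1..n} \<rightarrow>\<^sub>E C"

definition ising_weight :: "nat \<Rightarrow> real \<Rightarrow> (nat \<Rightarrow> 'c) \<Rightarrow> real" where
  "ising_weight n T x =
     exp (1 / T * (\<Sum>k\<in>{1..<n}. of_bool (x k = x (k + 1)) - of_bool (x k \<noteq> x (k + 1))))"

definition partition_fn :: "'c set \<Rightarrow> nat \<Rightarrow> real \<Rightarrow> real" where
  "partition_fn C n T = (\<Sum>x\<in>configs C n. ising_weight n T x)"

definition ising :: "'c set \<Rightarrow> nat \<Rightarrow> real \<Rightarrow> (nat \<Rightarrow> 'c) \<Rightarrow> real" where
  "ising C n T x = ising_weight n T x / partition_fn C n T"

definition ising_cond ::
  "'c set \<Rightarrow> nat \<Rightarrow> real \<Rightarrow> nat \<Rightarrow> 'c \<Rightarrow> (nat \<Rightarrow> 'c) \<Rightarrow> real" where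
  "ising_cond C n T i c x = ising C n T (x(i := c)) / (\<Sum>d\<in>C. ising C n T (x(i := d)))"

definition differ_only_at :: "nat \<Rightarrow> nat \<Rightarrow> (nat \<Rightarrow> 'c) \<Rightarrow> (nat \<Rightarrow> 'c) \<Rightarrow> bool" where
  "differ_only_at n i x y \<longleftrightarrow>
     i \<in> {1..n} \<and> x i \<noteq> y i \<and> (\<forall>j\<in>{1..n} - {i}. x j = y j)"

definition gibbs_kernel ::
  "'c set \<Rightarrow> nat \<Rightarrow> real \<Rightarrow> (nat \<Rightarrow> 'c) \<Rightarrow> (nat \<Rightarrow> 'c) \<Rightarrow> real" where
  "gibbs_kernel C n T x y =
    (if x = y then 1 - 1 / real n * (\<Sum>i\<in>{1..n}. \<Sum>c\<in>C - {x i}. ising_cond C n T i c x)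
     else if \<exists>i. differ_only_at n i x y
     then (let i = (THE i. differ_only_at n i x y) in 1 / real n * ising_cond C n T i (y i) x)
     else 0)"

text \<open>The matrix of a kernel on a finite set \<open>S\<close>, with rows and columns numbered by the
  bijection \<open>from_nat_into S\<close> from \<open>{..<card S}\<close> to \<open>S\<close>. The choice of numbering is
  irrelevant below, because the characteristic polynomial does not depend on it.\<close>

definition kernel_mat :: "'s set \<Rightarrow> ('s \<Rightarrow> 's \<Rightarrow> real) \<Rightarrow> real mat" where
  "kernel_mat S K =
     mat (card S) (card S) (\<lambda>(i, j). K (from_nat_into S i) (from_nat_into S j))"

text \<open>Real eigenvalues, repeated according to their multiplicity as roots of the characteristic
  polynomial, in decreasing order. For a reversible transition matrix all roots are real and the
  algebraic and geometric multiplicities agree, so the list has \<open>card S\<close> entries, and the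
  entry at index \<open>k\<close> is \<open>\<beta>\<^sub>k\<close>.\<close>

definition eigenvalues_desc :: "real mat \<Rightarrow> real list" where
  "eigenvalues_desc A = rev (sorted_list_of_multiset (proots (char_poly A)))"

definition gibbs_beta :: "'c set \<Rightarrow> nat \<Rightarrow> real \<Rightarrow> nat \<Rightarrow> real" where
  "gibbs_beta C n T k = eigenvalues_desc (kernel_mat (configs C n) (gibbs_kernel C n T)) ! k"

end

theory Submission
  imports Defs "HOL-Analysis.Convex" "Jordan_Normal_Form.Schur_Decomposition"
begin

text \<open>The proof bounds the spectral gap from below by a Poincare inequality obtained from canonical
  paths. Write \<open>w\<close> for the unnormalized weight of a configuration, \<open>N\<close> for the number of colors and
  \<open>M = exp (4 / T) + N - 1\<close>, so that the claim is that the second eigenvalue lies below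
  \<open>1 - N / (n\<^sup>2 * M)\<close>.

  For configurations \<open>x\<close> and \<open>y\<close>, replace the colors of \<open>x\<close> by those of \<open>y\<close> one site at a time
  from left to right. Telescoping and Cauchy-Schwarz bound \<open>(f x - f y)\<^sup>2\<close> by \<open>n\<close> times the sum of
  the squared increments of \<open>f\<close> along this path. Averaging over \<open>x\<close> and \<open>y\<close> turns the left side
  into the variance of \<open>f\<close>. On the right, the increments at site \<open>i\<close> belong to single-site updates,
  and the total weight of the paths through one such update can be computed exactly
  (\<open>path_congestion\<close>): the chain is one-dimensional, so that the two halves of \<open>x\<close> and \<open>y\<close>
  interact only across one bond, and the color at a site is uniform, which yields the factor
  \<open>1 / N\<close>. Comparing this weight with the rate of the update in the Gibbs sampler costs at most a
  factor \<open>M\<close> (\<open>sum_site_factors_le\<close>). Together the variance is at most \<open>n\<^sup>2 * M / N\<close> times the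
  Dirichlet form, and strictly less if \<open>f\<close> is not constant (\<open>ising_poincare\<close>).

  The passage from this inequality to eigenvalues holds for every reversible kernel on a finite set
  (\<open>second_eigenvalue_less\<close>). It has to show that all roots of the characteristic polynomial are real
  and, multiplicities being algebraic, that at most one of them is as large as the bound.\<close>

section \<open>Eigenvalues of reversible kernels\<close>

lemma sum_from_nat_into:
  assumes "finite S"
  shows "(\<Sum>i<card S. h (from_nat_into S i)) = (\<Sum>x\<in>S. h x)"
  by (rule sum.reindex_bij_betw[OF bij_betw_from_nat_into_finite[OF assms]])

text \<open>Vectors and columns of matrices are transported to functions on the state space, where the
  enumeration of the states no longer appears.\<close>

lemma function_of_entries:
  assumes "finite S"
  obtains f where "\<And>i. i < card S \<Longrightarrow> f (from_nat_into S i) = q i"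
proof
  fix i assume "i < card S"
  then show "(q \<circ> inv_into {..<card S} (from_nat_into S)) (from_nat_into S i) = q i"
    using bij_betw_from_nat_into_finite[OF assms] by (simp add: bij_betw_def inv_into_f_f)
qed

lemma obtain_index:
  assumes "finite S" "x \<in> S"
  obtains i where "i < card S" "x = from_nat_into S i"
  using bij_betw_from_nat_into_finite[OF assms(1)] assms(2)
  by (metis bij_betw_def imageE lessThan_iff)

lemma eigenfunction_of_root:
  fixes K :: "'s \<Rightarrow> 's \<Rightarrow> 'a::field"
  assumes S: "finite S"
    and root: "poly (char_poly
      (mat (card S) (card S) (\<lambda>(i, j). K (from_nat_into S i) (from_nat_into S j)))) e = 0"
  obtains f x0 where "x0 \<in> S" "f x0 \<noteq> 0" "\<And>x. x \<in> S \<Longrightarrow> (\<Sum>y\<in>S. K x y * f y) = e * f x"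
proof -
  let ?m = "card S" and ?s = "from_nat_into S"
  define A where "A = mat ?m ?m (\<lambda>(i, j). K (?s i) (?s j))"
  have A: "A \<in> carrier_mat ?m ?m" by (simp add: A_def)
  have "eigenvalue A e" using eigenvalue_root_char_poly[OF A] root by (simp add: A_def)
  then obtain v where v: "v \<in> carrier_vec ?m" "v \<noteq> 0\<^sub>v ?m" "A *\<^sub>v v = e \<cdot>\<^sub>v v"
    using A by (auto simp: eigenvalue_def eigenvector_def)
  obtain f where f: "\<And>i. i < ?m \<Longrightarrow> f (?s i) = v $ i"
    using function_of_entries[OF S, of "\<lambda>i. v $ i"] by blast
  from v(1,2) obtain i where i: "i < ?m" "v $ i \<noteq> 0"
    by (metis eq_vecI carrier_vecD index_zero_vec)
  have iS: "?s i \<in> S" using i(1) S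
    by (metis card.empty from_nat_into not_less_zero)
  show thesis
  proof (rule that[of "?s i" f])
    show "?s i \<in> S" by (rule iS)
    show "f (?s i) \<noteq> 0" using i f by simp
    fix x assume "x \<in> S"
    then obtain k where k: "k < ?m" "x = ?s k" by (rule obtain_index[OF S])
    have "(\<Sum>y\<in>S. K x y * f y) = (\<Sum>j<?m. K x (?s j) * f (?s j))"
      by (rule sum_from_nat_into[OF S, symmetric])
    also have "\<dots> = (\<Sum>j<?m. A $$ (k, j) * v $ j)"
      using k f by (intro sum.cong) (auto simp: A_def)
    also have "\<dots> = (A *\<^sub>v v) $ k"
      using A v(1) k by (simp add: scalar_prod_def lessThan_atLeast0)
    also have "\<dots> = e * f x" using v k f by simp
    finally show "(\<Sum>y\<in>S. K x y * f y) = e * f x" .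
  qed
qed

text \<open>Detailed balance makes the kernel self-adjoint for the inner product weighted by \<open>\<mu>\<close>. Hence
  the quadratic form \<open>Q\<close> of a complex eigenfunction equals its own conjugate, and it is also the
  eigenvalue times the positive squared norm \<open>c\<close>.\<close>

lemma reversible_root_real:
  fixes K :: "'s \<Rightarrow> 's \<Rightarrow> real"
  assumes S: "finite S" and pos: "\<And>x. x \<in> S \<Longrightarrow> 0 < \<mu> x"
    and rev: "\<And>x y. x \<in> S \<Longrightarrow> y \<in> S \<Longrightarrow> \<mu> x * K x y = \<mu> y * K y x"
    and root: "poly (char_poly (map_mat complex_of_real (kernel_mat S K))) e = 0"
  shows "Im e = 0"
proof -
  have "map_mat complex_of_real (kernel_mat S K) =
    mat (card S) (card S) (\<lambda>(i, j). complex_of_real (K (from_nat_into S i) (from_nat_into S j)))"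
    unfolding kernel_mat_def by (intro eq_matI) auto
  then obtain f x0 where x0: "x0 \<in> S" "f x0 \<noteq> 0"
    and f: "\<And>x. x \<in> S \<Longrightarrow> (\<Sum>y\<in>S. complex_of_real (K x y) * f y) = e * f x"
    using eigenfunction_of_root[OF S, of "\<lambda>x y. complex_of_real (K x y)" e] root by metis
  define Q where "Q = (\<Sum>x\<in>S. \<Sum>y\<in>S. of_real (\<mu> x * K x y) * cnj (f x) * f y)"
  define c where "c = (\<Sum>x\<in>S. \<mu> x * (cmod (f x))\<^sup>2)"
  have "Q = (\<Sum>x\<in>S. of_real (\<mu> x) * cnj (f x) * (\<Sum>y\<in>S. of_real (K x y) * f y))"
    unfolding Q_def sum_distrib_left by (simp add: mult_ac)
  also have "\<dots> = (\<Sum>x\<in>S. of_real (\<mu> x) * cnj (f x) * (e * f x))"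
    using f by (intro sum.cong) auto
  also have "\<dots> = e * of_real c"
    unfolding c_def of_real_sum sum_distrib_left
    by (intro sum.cong refl) (simp add: complex_norm_square mult_ac del: of_real_power)
  finally have Q: "Q = e * of_real c" .
  have "cnj Q = (\<Sum>x\<in>S. \<Sum>y\<in>S. of_real (\<mu> x * K x y) * f x * cnj (f y))"
    unfolding Q_def by simp
  also have "\<dots> = (\<Sum>y\<in>S. \<Sum>x\<in>S. of_real (\<mu> x * K x y) * f x * cnj (f y))"
    by (rule sum.swap)
  also have "\<dots> = Q"
    unfolding Q_def using rev by (intro sum.cong refl) (simp add: mult_ac flip: of_real_mult)
  finally have "cnj e * of_real c = e * of_real c" using Q by simp
  moreover have "c > 0"
    unfolding c_def using S x0 pos by (intro sum_pos2[OF S x0(1)]) (auto simp: less_imp_le)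
  ultimately have "cnj e = e" by simp
  then show ?thesis by (metis cnj.sel(2) equation_minus_iff neg_equal_zero)
qed

text \<open>The complex factorization has real roots only, and real polynomials embed injectively into
  complex ones. The splitting guarantees that the list of real eigenvalues has one entry per state,
  so that its entry at index 1 exists, and it is what the Schur decomposition asks for.\<close>

lemma reversible_char_poly_splits:
  fixes K :: "'s \<Rightarrow> 's \<Rightarrow> real"
  assumes S: "finite S" and pos: "\<And>x. x \<in> S \<Longrightarrow> 0 < \<mu> x"
    and rev: "\<And>x y. x \<in> S \<Longrightarrow> y \<in> S \<Longrightarrow> \<mu> x * K x y = \<mu> y * K y x"
  obtains es where "char_poly (kernel_mat S K) = (\<Prod>e\<leftarrow>es. [:- e, 1:])" "length es = card S"
proof -
  let ?A = "kernel_mat S K"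
  have A: "?A \<in> carrier_mat (card S) (card S)" by (simp add: kernel_mat_def)
  obtain as where as: "char_poly (map_mat complex_of_real ?A) = (\<Prod>a\<leftarrow>as. [:- a, 1:])"
    "length as = card S"
    using char_poly_factorized[of "map_mat complex_of_real ?A" "card S"] A by auto
  have "complex_of_real (Re a) = a" if "a \<in> set as" for a
  proof -
    have "poly (char_poly (map_mat complex_of_real ?A)) a = 0"
      using that unfolding as(1) by (auto simp: poly_prod_list prod_list_zero_iff)
    then show ?thesis
      using reversible_root_real[OF S pos rev] by (simp add: complex_eq_iff)
  qed
  then have "as = map complex_of_real (map Re as)" by (simp add: map_idI)
  moreover have "map_poly complex_of_real (\<Prod>a\<leftarrow>es. [:- a, 1:]) =
      (\<Prod>a\<leftarrow>map complex_of_real es. [:- a, 1:])" for es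
  proof -
    interpret h: map_poly_inj_comm_ring_hom complex_of_real ..
    show ?thesis
    proof (induction es)
      case (Cons a es)
      show ?case by (simp only: list.map prod_list.Cons h.hom_mult Cons) simp
    qed simp
  qed
  ultimately have "map_poly complex_of_real (char_poly ?A) =
      map_poly complex_of_real (\<Prod>a\<leftarrow>map Re as. [:- a, 1:])"
    using as(1) of_real_hom.char_poly_hom[OF A, where ?'a = complex] by metis
  then have "char_poly ?A = (\<Prod>a\<leftarrow>map Re as. [:- a, 1:])"
  proof -
    interpret h: map_poly_inj_comm_ring_hom complex_of_real ..
    assume "map_poly complex_of_real (char_poly ?A) =
      map_poly complex_of_real (\<Prod>a\<leftarrow>map Re as. [:- a, 1:])"
    then show ?thesis by (rule h.injectivity)
  qed
  then show thesis using as(2) by (intro that[of "map Re as"]) auto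
qed

lemma eigenvalues_desc_splitting:
  assumes "char_poly A = (\<Prod>e\<leftarrow>es. [:- e, 1:])"
  shows "char_poly A = (\<Prod>e\<leftarrow>eigenvalues_desc A. [:- e, 1:])"
    and "length (eigenvalues_desc A) = length es"
proof -
  have "proots (\<Prod>e\<leftarrow>es. [:- e, 1:]) = mset es"
  proof (induction es)
    case (Cons a es)
    have "(\<Prod>e\<leftarrow>es. [:- e, 1:]) \<noteq> 0" by (auto simp: prod_list_zero_iff)
    then show ?case using Cons by (simp add: proots_mult del: mult_pCons_left)
  qed simp
  then have m: "mset (eigenvalues_desc A) = mset es"
    using assms by (simp add: eigenvalues_desc_def)
  then show "length (eigenvalues_desc A) = length es" by (rule mset_eq_length)
  from m have "prod_mset (image_mset (\<lambda>e. [:- e, 1:]) (mset (eigenvalues_desc A))) =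
    prod_mset (image_mset (\<lambda>e. [:- e, 1:]) (mset es))" by simp
  then show "char_poly A = (\<Prod>e\<leftarrow>eigenvalues_desc A. [:- e, 1:])"
    using assms by (simp add: prod_mset_prod_list flip: mset_map)
qed

lemma variance_double_sum:
  fixes f \<mu> :: "'s \<Rightarrow> real"
  shows "(\<Sum>x\<in>S. \<Sum>y\<in>S. \<mu> x * \<mu> y * (f x - f y)\<^sup>2) =
    2 * (sum \<mu> S * (\<Sum>x\<in>S. \<mu> x * (f x)\<^sup>2) - (\<Sum>x\<in>S. \<mu> x * f x)\<^sup>2)"
proof -
  have "(\<Sum>x\<in>S. \<Sum>y\<in>S. \<mu> x * \<mu> y * (f x - f y)\<^sup>2) =
     (\<Sum>x\<in>S. \<Sum>y\<in>S. \<mu> y * (\<mu> x * (f x)\<^sup>2)) + (\<Sum>x\<in>S. \<Sum>y\<in>S. \<mu> x * (\<mu> y * (f y)\<^sup>2))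
       - 2 * (\<Sum>x\<in>S. \<Sum>y\<in>S. (\<mu> x * f x) * (\<mu> y * f y))"
    unfolding sum_distrib_left sum.distrib[symmetric] sum_subtractf[symmetric]
    by (intro sum.cong refl) (simp add: power2_eq_square algebra_simps)
  then show ?thesis
    by (simp add: power2_eq_square mult.commute flip: sum_product sum_distrib_left sum_distrib_right)
qed

lemma dirichlet_double_sum:
  fixes f \<mu> :: "'s \<Rightarrow> real"
  assumes stoch: "\<And>x. x \<in> S \<Longrightarrow> (\<Sum>y\<in>S. K x y) = 1"
    and rev: "\<And>x y. x \<in> S \<Longrightarrow> y \<in> S \<Longrightarrow> \<mu> x * K x y = \<mu> y * K y x"
  shows "(\<Sum>x\<in>S. \<Sum>y\<in>S. \<mu> x * K x y * (f x - f y)\<^sup>2) =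
    2 * ((\<Sum>x\<in>S. \<mu> x * (f x)\<^sup>2) - (\<Sum>x\<in>S. \<mu> x * f x * (\<Sum>y\<in>S. K x y * f y)))"
proof -
  have 1: "(\<Sum>x\<in>S. \<Sum>y\<in>S. \<mu> x * K x y * (f x)\<^sup>2) = (\<Sum>x\<in>S. \<mu> x * (f x)\<^sup>2)"
  proof (intro sum.cong refl)
    fix x assume "x \<in> S"
    have "(\<Sum>y\<in>S. \<mu> x * K x y * (f x)\<^sup>2) = \<mu> x * (f x)\<^sup>2 * (\<Sum>y\<in>S. K x y)"
      unfolding sum_distrib_left by (simp add: mult_ac)
    then show "(\<Sum>y\<in>S. \<mu> x * K x y * (f x)\<^sup>2) = \<mu> x * (f x)\<^sup>2" using stoch[OF \<open>x \<in> S\<close>] by simp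
  qed
  have "(\<Sum>x\<in>S. \<Sum>y\<in>S. \<mu> x * K x y * (f y)\<^sup>2) = (\<Sum>y\<in>S. \<Sum>x\<in>S. \<mu> x * K x y * (f y)\<^sup>2)"
    by (rule sum.swap)
  also have "\<dots> = (\<Sum>y\<in>S. \<Sum>x\<in>S. \<mu> y * K y x * (f y)\<^sup>2)"
    using rev by (intro sum.cong refl) simp
  finally have 2: "(\<Sum>x\<in>S. \<Sum>y\<in>S. \<mu> x * K x y * (f y)\<^sup>2) = (\<Sum>x\<in>S. \<mu> x * (f x)\<^sup>2)"
    using 1 by simp
  have "(\<Sum>x\<in>S. \<Sum>y\<in>S. \<mu> x * K x y * (f x - f y)\<^sup>2) =
     (\<Sum>x\<in>S. \<Sum>y\<in>S. \<mu> x * K x y * (f x)\<^sup>2) + (\<Sum>x\<in>S. \<Sum>y\<in>S. \<mu> x * K x y * (f y)\<^sup>2)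
       - 2 * (\<Sum>x\<in>S. \<mu> x * f x * (\<Sum>y\<in>S. K x y * f y))"
    unfolding sum_distrib_left sum.distrib[symmetric] sum_subtractf[symmetric]
    by (intro sum.cong refl) (simp add: power2_eq_square algebra_simps)
  then show ?thesis unfolding 1 2 by simp
qed

text \<open>An eigenfunction \<open>f\<close> for \<open>e\<close> has Dirichlet form proportional to \<open>1 - e\<close>. For \<open>e \<noteq> 1\<close> it has
  mean zero, so that its variance is its squared norm, and the strict Poincare inequality forces
  \<open>e < 1 - g\<close> unless \<open>f\<close> is constant. This handles single eigenvalues but not multiplicities, which
  are taken in the characteristic polynomial. Therefore the two largest roots are placed first in a
  Schur triangularization: if both were at least \<open>1 - g\<close>, the first two columns of the
  transforming matrix, read as functions, would both be constant, against its invertibility.\<close>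

lemma second_eigenvalue_less:
  fixes K :: "'s \<Rightarrow> 's \<Rightarrow> real"
  assumes S: "finite S" "2 \<le> card S" and pos: "\<And>x. x \<in> S \<Longrightarrow> 0 < \<mu> x"
    and stoch: "\<And>x. x \<in> S \<Longrightarrow> (\<Sum>y\<in>S. K x y) = 1"
    and rev: "\<And>x y. x \<in> S \<Longrightarrow> y \<in> S \<Longrightarrow> \<mu> x * K x y = \<mu> y * K y x"
    and g: "0 \<le> g"
    and poincare: "\<And>f :: 's \<Rightarrow> real. \<exists>x\<in>S. \<exists>y\<in>S. f x \<noteq> f y \<Longrightarrow>
      g * (\<Sum>x\<in>S. \<Sum>y\<in>S. \<mu> x * \<mu> y * (f x - f y)\<^sup>2) <
      sum \<mu> S * (\<Sum>x\<in>S. \<Sum>y\<in>S. \<mu> x * K x y * (f x - f y)\<^sup>2)"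
  shows "eigenvalues_desc (kernel_mat S K) ! 1 < 1 - g"
proof (rule ccontr)
  assume neg: "\<not> ?thesis"
  let ?m = "card S" and ?s = "from_nat_into S"
  let ?A = "kernel_mat S K"
  let ?es = "eigenvalues_desc ?A"
  have A: "?A \<in> carrier_mat ?m ?m" by (simp add: kernel_mat_def)
  obtain es0 where "char_poly ?A = (\<Prod>e\<leftarrow>es0. [:- e, 1:])" "length es0 = ?m"
    using reversible_char_poly_splits[of S \<mu> K] S(1) pos rev by blast
  then have cp: "char_poly ?A = (\<Prod>e\<leftarrow>?es. [:- e, 1:])" and len: "length ?es = ?m"
    using eigenvalues_desc_splitting by metis+
  have desc: "?es ! 1 \<le> ?es ! 0"
  proof -
    have "sorted (rev ?es)" by (simp add: eigenvalues_desc_def)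
    then show ?thesis using S(2) len by (simp add: sorted_rev_iff_nth_mono)
  qed
  have sumpos: "0 < sum \<mu> S" using S pos by (intro sum_pos) auto
  \<comment> \<open>Reversibility makes \<open>\<mu>\<close> stationary.\<close>
  have Z: "(\<Sum>x\<in>S. \<mu> x * (\<Sum>y\<in>S. K x y * f y)) = (\<Sum>x\<in>S. \<mu> x * f x)" for f
  proof -
    have "(\<Sum>x\<in>S. \<mu> x * (\<Sum>y\<in>S. K x y * f y)) = (\<Sum>x\<in>S. \<Sum>y\<in>S. \<mu> x * K x y * f y)"
      by (simp add: sum_distrib_left mult_ac)
    also have "\<dots> = (\<Sum>y\<in>S. \<Sum>x\<in>S. \<mu> x * K x y * f y)" by (rule sum.swap)
    also have "\<dots> = (\<Sum>y\<in>S. \<Sum>x\<in>S. \<mu> y * f y * K y x)"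
      using rev by (intro sum.cong refl) (simp add: mult_ac)
    also have "\<dots> = (\<Sum>y\<in>S. \<mu> y * f y)"
      using stoch by (intro sum.cong) (auto simp flip: sum_distrib_left)
    finally show ?thesis .
  qed
  have const: "f x = f y"
    if f: "\<And>x. x \<in> S \<Longrightarrow> (\<Sum>y\<in>S. K x y * f y) = e * f x" and e: "1 - g \<le> e"
      and xy: "x \<in> S" "y \<in> S" for f e x y
  proof (rule ccontr)
    assume "f x \<noteq> f y"
    with xy have lt: "g * (\<Sum>x\<in>S. \<Sum>y\<in>S. \<mu> x * \<mu> y * (f x - f y)\<^sup>2) <
      sum \<mu> S * (\<Sum>x\<in>S. \<Sum>y\<in>S. \<mu> x * K x y * (f x - f y)\<^sup>2)" by (intro poincare) auto
    define q where "q = (\<Sum>x\<in>S. \<mu> x * (f x)\<^sup>2)"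
    define m where "m = (\<Sum>x\<in>S. \<mu> x * f x)"
    have "(\<Sum>x\<in>S. \<mu> x * f x * (\<Sum>y\<in>S. K x y * f y)) = e * q"
      unfolding q_def sum_distrib_left using f
      by (intro sum.cong refl) (simp add: power2_eq_square sum_distrib_left[symmetric])
    with lt have lt': "g * (sum \<mu> S * q - m\<^sup>2) < sum \<mu> S * ((1 - e) * q)"
      by (simp only: dirichlet_double_sum[of S K \<mu> f, OF stoch rev] variance_double_sum
          flip: q_def m_def) (simp add: algebra_simps)
    have "m = (\<Sum>x\<in>S. \<mu> x * (\<Sum>y\<in>S. K x y * f y))" by (simp only: m_def Z)
    also have "\<dots> = e * m"
      unfolding m_def sum_distrib_left[of e]
      using f by (intro sum.cong refl) (simp add: mult.left_commute)
    finally have "m = e * m" .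
    then consider "m = 0" | "e = 1" by auto
    then show False
    proof cases
      case 1
      have "q \<ge> 0" unfolding q_def using pos by (intro sum_nonneg) (simp add: less_imp_le)
      then have "(1 - e) * (sum \<mu> S * q) \<le> g * (sum \<mu> S * q)"
        using e sumpos by (intro mult_right_mono) auto
      with lt' 1 show False by (simp add: mult_ac)
    next
      case 2
      have "0 \<le> (\<Sum>x\<in>S. \<Sum>y\<in>S. \<mu> x * \<mu> y * (f x - f y)\<^sup>2)"
        using pos by (intro sum_nonneg) (simp add: less_imp_le)
      then have "0 \<le> g * (sum \<mu> S * q - m\<^sup>2)"
        using g variance_double_sum[of \<mu> f S] by (simp add: q_def m_def)
      with lt' 2 show False by simp
    qed
  qed
  obtain B P Q where dec: "schur_decomposition ?A ?es = (B, P, Q)" by (metis prod_cases3)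
  have wit: "similar_mat_wit ?A B P Q" and ut: "upper_triangular B" and dB: "diag_mat B = ?es"
    using schur_decomposition[OF A cp dec] by auto
  have c: "B \<in> carrier_mat ?m ?m" "P \<in> carrier_mat ?m ?m" "Q \<in> carrier_mat ?m ?m"
    and QP: "Q * P = 1\<^sub>m ?m" and APBQ: "?A = P * B * Q"
    using wit A unfolding similar_mat_wit_def Let_def by auto
  have AP: "?A * P = P * B"
    using c QP unfolding APBQ by (simp add: assoc_mult_mat[of _ ?m ?m _ ?m _ ?m])
  \<comment> \<open>Triangularity: the first column is an eigenfunction, the second one is an eigenfunction up to
    a multiple of the first.\<close>
  have B00: "B $$ (0, 0) = ?es ! 0" and B11: "B $$ (1, 1) = ?es ! 1"
    using S(2) c(1) by (simp_all add: diag_mat_def flip: dB)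
  have B10: "B $$ (i, j) = 0" if "j < i" "i < ?m" for i j
    using ut that c(1) by (auto simp: upper_triangular_def)
  have entry: "(\<Sum>k<?m. ?A $$ (i, k) * P $$ (k, j)) = (\<Sum>k<?m. P $$ (i, k) * B $$ (k, j))"
    if "i < ?m" "j < ?m" for i j
  proof -
    have "(?A * P) $$ (i, j) = (P * B) $$ (i, j)" by (simp add: AP)
    then show ?thesis using A c that by (simp add: scalar_prod_def lessThan_atLeast0)
  qed
  have Qentry: "(\<Sum>k<?m. Q $$ (i, k) * P $$ (k, j)) = of_bool (i = j)" if "i < ?m" "j < ?m" for i j
  proof -
    have "(Q * P) $$ (i, j) = of_bool (i = j)" using that by (simp add: QP)
    then show ?thesis using c that by (simp add: scalar_prod_def lessThan_atLeast0)
  qed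
  obtain f0 where f0: "\<And>i. i < ?m \<Longrightarrow> f0 (?s i) = P $$ (i, 0)"
    using function_of_entries[OF S(1), of "\<lambda>i. P $$ (i, 0)"] by blast
  obtain f1 where f1: "\<And>i. i < ?m \<Longrightarrow> f1 (?s i) = P $$ (i, 1)"
    using function_of_entries[OF S(1), of "\<lambda>i. P $$ (i, 1)"] by blast
  have ap: "(\<Sum>y\<in>S. K (?s i) y * f y) = (\<Sum>k<?m. ?A $$ (i, k) * P $$ (k, j))"
    if "i < ?m" and "\<And>i. i < ?m \<Longrightarrow> f (?s i) = P $$ (i, j)" for f i j
    unfolding sum_from_nat_into[OF S(1), symmetric] using that
    by (intro sum.cong refl) (auto simp: kernel_mat_def)
  have K0: "(\<Sum>y\<in>S. K x y * f0 y) = ?es ! 0 * f0 x" if x: "x \<in> S" for x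
  proof -
    obtain i where i: "i < ?m" "x = ?s i" by (rule obtain_index[OF S(1) x])
    have "(\<Sum>k<?m. P $$ (i, k) * B $$ (k, 0)) = (\<Sum>k\<in>{0}. P $$ (i, k) * B $$ (k, 0))"
      using S(2) B10[of 0] by (intro sum.mono_neutral_right) auto
    with ap[OF i(1) f0] entry[OF i(1), of 0] S(2) f0[OF i(1)] i B00 show ?thesis by simp
  qed
  have K1: "(\<Sum>y\<in>S. K x y * f1 y) = ?es ! 1 * f1 x + B $$ (0, 1) * f0 x" if x: "x \<in> S" for x
  proof -
    obtain i where i: "i < ?m" "x = ?s i" by (rule obtain_index[OF S(1) x])
    have "(\<Sum>k<?m. P $$ (i, k) * B $$ (k, 1)) = (\<Sum>k\<in>{0, 1}. P $$ (i, k) * B $$ (k, 1))"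
      using S(2) B10[of 1] by (intro sum.mono_neutral_right) auto
    with ap[OF i(1) f1] entry[OF i(1), of 1] S(2) f0[OF i(1)] f1[OF i(1)] i B11
    show ?thesis by simp
  qed
  obtain x0 where x0: "x0 \<in> S" using S by fastforce
  define a where "a = f0 x0"
  have a: "f0 x = a" if "x \<in> S" for x
    using const[OF K0 _ that x0] neg desc by (simp add: a_def)
  have sS: "?s k \<in> S" if "k < ?m" for k
    using that by (metis card.empty from_nat_into not_less_zero)
  have Qa: "(\<Sum>k<?m. Q $$ (i, k)) * a = of_bool (i = 0)" if "i < ?m" for i
  proof -
    have "P $$ (k, 0) = a" if "k < ?m" for k using f0[OF that] a[OF sS[OF that]] by simp
    then have "(\<Sum>k<?m. Q $$ (i, k)) * a = (\<Sum>k<?m. Q $$ (i, k) * P $$ (k, 0))"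
      unfolding sum_distrib_right by (intro sum.cong) auto
    then show ?thesis using Qentry[OF that, of 0] S(2) by simp
  qed
  have a0: "a \<noteq> 0" using Qa[of 0] S(2) by auto
  have e0: "?es ! 0 = 1"
    using K0[OF x0] a0 a x0 stoch[OF x0] by (simp flip: sum_distrib_right)
  define e where "e = ?es ! 1"
  define t where "t = B $$ (0, 1)"
  have K1': "(\<Sum>y\<in>S. K x y * f1 y) = e * f1 x + t * a" if "x \<in> S" for x
    using K1[OF that] a[OF that] by (simp add: e_def t_def)
  \<comment> \<open>No Jordan block at 1, because averaging against the stationary \<open>\<mu>\<close> removes \<open>f1\<close>.\<close>
  have t0: "t = 0" if "e = 1"
  proof -
    have "(\<Sum>x\<in>S. \<mu> x * f1 x) = (\<Sum>x\<in>S. \<mu> x * (f1 x + t * a))"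
      using Z[of f1] K1' that by simp
    also have "\<dots> = (\<Sum>x\<in>S. \<mu> x * f1 x) + sum \<mu> S * (t * a)"
      by (simp add: distrib_left sum.distrib sum_distrib_right)
    finally show ?thesis using a0 sumpos by simp
  qed
  \<comment> \<open>The shift that turns \<open>f1\<close> into a genuine eigenfunction; for \<open>e = 1\<close> division by zero yields
    \<open>s = 0\<close>, which is correct since then \<open>t = 0\<close>.\<close>
  define s where "s = t / (e - 1)"
  have s: "t + s = e * s"
    using t0 by (cases "e = 1") (auto simp: s_def field_simps)
  have f1_const: "f1 x = f1 x0" if "x \<in> S" for x
  proof -
    have "(\<Sum>y\<in>S. K x y * (f1 y + s * a)) = e * (f1 x + s * a)" if "x \<in> S" for x
    proof -
      have "(\<Sum>y\<in>S. K x y * (f1 y + s * a)) = e * f1 x + t * a + s * a"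
        using K1'[OF that] stoch[OF that]
        by (simp add: distrib_left sum.distrib flip: sum_distrib_right)
      also have "\<dots> = e * f1 x + (t + s) * a" by (simp add: distrib_right)
      finally show ?thesis unfolding s by (simp add: algebra_simps)
    qed
    then have "f1 x + s * a = f1 x0 + s * a"
      using const[of "\<lambda>x. f1 x + s * a" e x x0] neg that x0 by (simp add: e_def)
    then show ?thesis by simp
  qed
  \<comment> \<open>Both columns being constant, row 1 of \<open>Q\<close> would have sum zero by the first and nonzero sum by
    the second.\<close>
  have "(\<Sum>k<?m. Q $$ (1, k)) * f1 x0 = (\<Sum>k<?m. Q $$ (1, k) * P $$ (k, 1))"
    unfolding sum_distrib_right
  proof (intro sum.cong refl)
    fix k assume "k \<in> {..<?m}"
    then show "Q $$ (1, k) * f1 x0 = Q $$ (1, k) * P $$ (k, 1)"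
      using f1 f1_const[OF sS[of k]] by simp
  qed
  also have "\<dots> = 1" using Qentry[of 1 1] S(2) by simp
  finally show False using Qa[of 1] a0 S(2) by simp
qed

section \<open>Ising weights\<close>

definition bond_weight :: "real \<Rightarrow> 'c \<Rightarrow> 'c \<Rightarrow> real" where
  "bond_weight T a b = exp ((of_bool (a = b) - of_bool (a \<noteq> b)) / T)"

text \<open>The weight of a configuration depends on the color at a site only through its two bonds. At an
  end of the chain the missing bond counts as the factor 1, which lets all sites be treated alike.\<close>

definition left_factor :: "real \<Rightarrow> (nat \<Rightarrow> 'c) \<Rightarrow> nat \<Rightarrow> 'c \<Rightarrow> real" where
  "left_factor T x i c = (if i = 1 then 1 else bond_weight T (x (i - 1)) c)"

definition right_factor :: "nat \<Rightarrow> real \<Rightarrow> (nat \<Rightarrow> 'c) \<Rightarrow> nat \<Rightarrow> 'c \<Rightarrow> real" where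
  "right_factor n T x i c = (if i = n then 1 else bond_weight T c (x (i + 1)))"

definition chain_weight :: "real \<Rightarrow> (nat \<Rightarrow> 'c) \<Rightarrow> nat \<Rightarrow> nat \<Rightarrow> real" where
  "chain_weight T x a b = (\<Prod>k\<in>{a..<b}. bond_weight T (x k) (x (k + 1)))"

lemma bond_weight_pos: "0 < bond_weight T a b"
  by (simp add: bond_weight_def)

lemma ising_weight_pos: "0 < ising_weight n T x"
  by (simp add: ising_weight_def)

lemma ising_weight_eq_chain_weight: "ising_weight n T x = chain_weight T x 1 n"
  unfolding ising_weight_def chain_weight_def bond_weight_def
  by (simp add: exp_sum sum_distrib_left)

lemma ising_weight_factorization:
  assumes "i \<in> {1..n}"
  shows "ising_weight n T x = chain_weight T x 1 (i - 1) * left_factor T x i (x i) *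
    right_factor n T x i (x i) * chain_weight T x (Suc i) n"
proof -
  have "chain_weight T x 1 n = chain_weight T x 1 i * chain_weight T x i n"
    unfolding chain_weight_def by (rule prod.atLeastLessThan_concat[symmetric]) (use assms in auto)
  moreover have "chain_weight T x 1 i = chain_weight T x 1 (i - 1) * left_factor T x i (x i)"
  proof (cases "i = 1")
    case False
    then obtain k where "i = Suc k" "1 \<le> k" using assms by (cases i) auto
    then show ?thesis by (simp add: chain_weight_def left_factor_def)
  qed (simp add: chain_weight_def left_factor_def)
  moreover have "chain_weight T x i n = right_factor n T x i (x i) * chain_weight T x (Suc i) n"
    using assms by (cases "i = n")
      (auto simp: chain_weight_def right_factor_def prod.atLeast_Suc_lessThan)
  ultimately show ?thesis by (simp add: ising_weight_eq_chain_weight)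
qed

lemma chain_weight_cong:
  assumes "\<And>k. a \<le> k \<Longrightarrow> k \<le> b \<Longrightarrow> x k = y k"
  shows "chain_weight T x a b = chain_weight T y a b"
  unfolding chain_weight_def using assms by (intro prod.cong) auto

lemma left_factor_cong: "x (i - 1) = y (i - 1) \<Longrightarrow> left_factor T x i c = left_factor T y i c"
  by (simp add: left_factor_def)

lemma right_factor_cong:
  "x (i + 1) = y (i + 1) \<Longrightarrow> right_factor n T x i c = right_factor n T y i c"
  by (simp add: right_factor_def)

lemma left_factor_pos: "0 < left_factor T x i c"
  by (simp add: left_factor_def bond_weight_pos)

lemma right_factor_pos: "0 < right_factor n T x i c"
  by (simp add: right_factor_def bond_weight_pos)

lemma chain_weight_pos: "0 < chain_weight T x a b"
  unfolding chain_weight_def by (intro prod_pos) (simp add: bond_weight_pos)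

lemma chain_weight_map:
  assumes "inj \<sigma>"
  shows "chain_weight T (\<lambda>k. \<sigma> (x k)) a b = chain_weight T x a b"
  using assms by (simp add: chain_weight_def bond_weight_def inj_eq)

lemma ising_weight_update:
  assumes "i \<in> {1..n}"
  shows "ising_weight n T (x(i := c)) = chain_weight T x 1 (i - 1) * left_factor T x i c *
    right_factor n T x i c * chain_weight T x (Suc i) n"
proof -
  have "chain_weight T (x(i := c)) 1 (i - 1) = chain_weight T x 1 (i - 1)"
    by (rule chain_weight_cong) (use assms in auto)
  moreover have "chain_weight T (x(i := c)) (Suc i) n = chain_weight T x (Suc i) n"
    by (rule chain_weight_cong) auto
  moreover have "left_factor T (x(i := c)) i c = left_factor T x i c"
    by (rule left_factor_cong) (use assms in auto)
  moreover have "right_factor n T (x(i := c)) i c = right_factor n T x i c"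
    by (rule right_factor_cong) auto
  ultimately show ?thesis by (simp add: ising_weight_factorization[OF assms])
qed

lemma finite_configs: "finite C \<Longrightarrow> finite (configs C n)"
  by (simp add: configs_def finite_PiE)

lemma configs_update: "x \<in> configs C n \<Longrightarrow> i \<in> {1..n} \<Longrightarrow> c \<in> C \<Longrightarrow> x(i := c) \<in> configs C n"
  unfolding configs_def by (auto simp: PiE_iff extensional_def)

lemma configs_in_colors: "x \<in> configs C n \<Longrightarrow> i \<in> {1..n} \<Longrightarrow> x i \<in> C"
  by (auto simp: configs_def)

lemma configs_outside: "x \<in> configs C n \<Longrightarrow> i \<notin> {1..n} \<Longrightarrow> x i = undefined"
  by (auto simp: configs_def PiE_iff extensional_def)

lemma configsI:
  "(\<And>i. i \<in> {1..n} \<Longrightarrow> x i \<in> C) \<Longrightarrow> (\<And>i. i \<notin> {1..n} \<Longrightarrow> x i = undefined) \<Longrightarrow>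
    x \<in> configs C n"
  unfolding configs_def by (auto simp: PiE_iff extensional_def)

lemma configs_eqI:
  assumes "x \<in> configs C n" "y \<in> configs C n" "\<And>i. i \<in> {1..n} \<Longrightarrow> x i = y i"
  shows "x = y"
  using assms unfolding configs_def by (rule PiE_ext)

lemma partition_fn_pos:
  assumes "finite C" "C \<noteq> {}"
  shows "0 < partition_fn C n T"
  unfolding partition_fn_def using assms
  by (intro sum_pos finite_configs) (auto simp: configs_def PiE_eq_empty_iff ising_weight_pos)

lemma ising_cond_eq:
  assumes "finite C" "C \<noteq> {}"
  shows "ising_cond C n T i c x = ising_weight n T (x(i := c)) / (\<Sum>d\<in>C. ising_weight n T (x(i := d)))"
  using partition_fn_pos[OF assms, of n T]
  by (simp add: ising_cond_def ising_def flip: sum_divide_distrib)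

section \<open>The kernel of the Gibbs sampler and its Dirichlet form\<close>

lemma differ_only_at_commute: "differ_only_at n i x y = differ_only_at n i y x"
proof -
  have "x j = y j \<longleftrightarrow> y j = x j" for j by (rule eq_commute)
  then show ?thesis unfolding differ_only_at_def by presburger
qed

lemma differ_only_at_unique: "differ_only_at n i x y \<Longrightarrow> differ_only_at n j x y \<Longrightarrow> i = j"
  by (auto simp: differ_only_at_def)

lemma gibbs_kernel_differ:
  assumes "differ_only_at n i x y"
  shows "gibbs_kernel C n T x y = ising_cond C n T i (y i) x / real n"
proof -
  have "(THE i. differ_only_at n i x y) = i"
    using assms differ_only_at_unique by (intro the_equality) blast+
  moreover have "x \<noteq> y" using assms by (auto simp: differ_only_at_def)
  ultimately show ?thesis using assms by (auto simp: gibbs_kernel_def)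
qed

lemma differ_only_at_configs_iff:
  assumes "x \<in> configs C n" "y \<in> configs C n"
  shows "differ_only_at n i x y \<longleftrightarrow> i \<in> {1..n} \<and> (\<exists>c\<in>C - {x i}. y = x(i := c))"
proof
  assume d: "differ_only_at n i x y"
  then have "y = x(i := y i)"
    by (intro configs_eqI[OF assms(2) configs_update[OF assms(1)]])
      (auto simp: differ_only_at_def intro!: configs_in_colors[OF assms(2)])
  with d show "i \<in> {1..n} \<and> (\<exists>c\<in>C - {x i}. y = x(i := c))"
    using configs_in_colors[OF assms(2), of i] by (auto simp: differ_only_at_def)
qed (auto simp: differ_only_at_def split: if_splits)

text \<open>The moves of the sampler out of \<open>x\<close> are parametrized, without repetition, by the pairs of a site
  and a color different from the present one.\<close>

lemma sum_gibbs_kernel: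
  assumes C: "finite C" and x: "x \<in> configs C n"
  shows "(\<Sum>y\<in>configs C n. gibbs_kernel C n T x y * g y) = gibbs_kernel C n T x x * g x +
    1 / real n * (\<Sum>i\<in>{1..n}. \<Sum>c\<in>C - {x i}. ising_cond C n T i c x * g (x(i := c)))"
proof -
  let ?P = "gibbs_kernel C n T"
  let ?I = "SIGMA i:{1..n}. C - {x i}"
  let ?h = "\<lambda>(i, c). x(i := c)"
  have inj: "inj_on ?h ?I"
  proof (rule inj_onI)
    fix p q assume "p \<in> ?I" "q \<in> ?I" and eq: "?h p = ?h q"
    moreover obtain i c j d where "p = (i, c)" "q = (j, d)" by (metis surj_pair)
    ultimately have "c \<noteq> x i" "x(i := c) = x(j := d)" by auto
    then have "i = j" "c = d" by (metis fun_upd_apply)+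
    with \<open>p = (i, c)\<close> \<open>q = (j, d)\<close> show "p = q" by simp
  qed
  have sub: "?h ` ?I \<subseteq> configs C n - {x}"
  proof
    fix y assume "y \<in> ?h ` ?I"
    then obtain p where "p \<in> ?I" "y = ?h p" by blast
    moreover obtain i c where "p = (i, c)" by (metis surj_pair)
    ultimately have y: "y = x(i := c)" "i \<in> {1..n}" "c \<in> C" "c \<noteq> x i" by auto
    then have "y \<noteq> x" by (metis fun_upd_same)
    then show "y \<in> configs C n - {x}" using configs_update[OF x y(2,3)] y(1) by simp
  qed
  have zero: "?P x y * g y = 0" if y: "y \<in> configs C n - {x} - ?h ` ?I" for y
  proof -
    have "\<not> differ_only_at n i x y" for i
      using y differ_only_at_configs_iff[OF x, of y i] by force
    then show ?thesis using y by (auto simp: gibbs_kernel_def)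
  qed
  have "(\<Sum>y\<in>configs C n. ?P x y * g y) = ?P x x * g x + (\<Sum>y\<in>configs C n - {x}. ?P x y * g y)"
    by (rule sum.remove[OF finite_configs[OF C] x])
  also have "(\<Sum>y\<in>configs C n - {x}. ?P x y * g y) = (\<Sum>y\<in>?h ` ?I. ?P x y * g y)"
    using zero sub C by (intro sum.mono_neutral_right) (auto simp: finite_configs)
  also have "\<dots> = (\<Sum>p\<in>?I. ?P x (?h p) * g (?h p))"
    using inj by (simp add: sum.reindex)
  also have "\<dots> = (\<Sum>(i, c)\<in>?I. 1 / real n * (ising_cond C n T i c x * g (x(i := c))))"
  proof (rule sum.cong[OF refl])
    fix p assume p: "p \<in> ?I"
    obtain i c where ic: "p = (i, c)" by (metis surj_pair)
    with p have "differ_only_at n i x (x(i := c))" by (auto simp: differ_only_at_def)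
    from gibbs_kernel_differ[OF this, of C T]
    show "?P x (?h p) * g (?h p) =
      (case p of (i, c) \<Rightarrow> 1 / real n * (ising_cond C n T i c x * g (x(i := c))))"
      by (simp add: ic)
  qed
  also have "\<dots> = 1 / real n * (\<Sum>i\<in>{1..n}. \<Sum>c\<in>C - {x i}. ising_cond C n T i c x * g (x(i := c)))"
    using C by (simp add: sum_distrib_left flip: sum.Sigma)
  finally show ?thesis .
qed

lemma gibbs_kernel_stochastic:
  assumes "finite C" "x \<in> configs C n"
  shows "(\<Sum>y\<in>configs C n. gibbs_kernel C n T x y) = 1"
  using sum_gibbs_kernel[OF assms, of T "\<lambda>_. 1"] by (simp add: gibbs_kernel_def)

lemma gibbs_kernel_reversible:
  assumes C: "finite C" "C \<noteq> {}" and xy: "x \<in> configs C n" "y \<in> configs C n"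
  shows "ising_weight n T x * gibbs_kernel C n T x y = ising_weight n T y * gibbs_kernel C n T y x"
proof (cases "\<exists>i. differ_only_at n i x y")
  case True
  then obtain i where i: "differ_only_at n i x y" by blast
  then have i': "differ_only_at n i y x" by (simp add: differ_only_at_commute)
  obtain c where "y = x(i := c)" using differ_only_at_configs_iff[OF xy] i by blast
  then show ?thesis
    using gibbs_kernel_differ[OF i, of C T] gibbs_kernel_differ[OF i', of C T]
    by (simp add: ising_cond_eq[OF C])
next
  case False
  then have "\<not> (\<exists>i. differ_only_at n i y x)" by (simp add: differ_only_at_commute)
  with False show ?thesis by (cases "x = y") (auto simp: gibbs_kernel_def)
qed

lemma gibbs_dirichlet_form:
  assumes C: "finite C"
  shows "(\<Sum>x\<in>configs C n. \<Sum>y\<in>configs C n. \<mu> x * gibbs_kernel C n T x y * (f x - f y)\<^sup>2) =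
    1 / real n * (\<Sum>i\<in>{1..n}. \<Sum>x\<in>configs C n. \<Sum>c\<in>C.
      \<mu> x * ising_cond C n T i c x * (f (x(i := c)) - f x)\<^sup>2)" (is "?l = ?r")
proof -
  have "?l = (\<Sum>x\<in>configs C n. 1 / real n * (\<Sum>i\<in>{1..n}. \<Sum>c\<in>C.
      \<mu> x * ising_cond C n T i c x * (f (x(i := c)) - f x)\<^sup>2))"
  proof (intro sum.cong refl)
    fix x assume x: "x \<in> configs C n"
    have "(\<Sum>y\<in>configs C n. \<mu> x * gibbs_kernel C n T x y * (f x - f y)\<^sup>2) =
      \<mu> x * (\<Sum>y\<in>configs C n. gibbs_kernel C n T x y * (f x - f y)\<^sup>2)"
      by (simp add: sum_distrib_left mult.assoc)
    also have "\<dots> = 1 / real n * (\<Sum>i\<in>{1..n}. \<Sum>c\<in>C - {x i}.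
        \<mu> x * ising_cond C n T i c x * (f (x(i := c)) - f x)\<^sup>2)"
      using sum_gibbs_kernel[OF C x, of T "\<lambda>y. (f x - f y)\<^sup>2"]
      by (simp add: sum_distrib_left mult.assoc mult.left_commute power2_commute[of "f x"])
    also have "(\<Sum>i\<in>{1..n}. \<Sum>c\<in>C - {x i}. \<mu> x * ising_cond C n T i c x * (f (x(i := c)) - f x)\<^sup>2)
        = (\<Sum>i\<in>{1..n}. \<Sum>c\<in>C. \<mu> x * ising_cond C n T i c x * (f (x(i := c)) - f x)\<^sup>2)"
      using C by (intro sum.cong refl sum.mono_neutral_left) auto
    finally show "(\<Sum>y\<in>configs C n. \<mu> x * gibbs_kernel C n T x y * (f x - f y)\<^sup>2) = 1 / real n *
        (\<Sum>i\<in>{1..n}. \<Sum>c\<in>C. \<mu> x * ising_cond C n T i c x * (f (x(i := c)) - f x)\<^sup>2)" .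
  qed
  also have "\<dots> = ?r" unfolding sum_distrib_left[symmetric] by (subst sum.swap) (rule refl)
  finally show ?thesis .
qed

section \<open>Color symmetry and canonical paths\<close>

text \<open>The color at a single site is uniformly distributed, because exchanging two colors at all sites
  preserves the weight.\<close>

lemma card_times_sum_color_fixed:
  assumes C: "finite C" and i: "i \<in> {1..n}" and a: "a \<in> C"
  shows "real (card C) * (\<Sum>v | v \<in> configs C n \<and> v i = a. ising_weight n T v) = partition_fn C n T"
proof -
  have eq: "(\<Sum>v | v \<in> configs C n \<and> v i = b. ising_weight n T v) =
      (\<Sum>v | v \<in> configs C n \<and> v i = a. ising_weight n T v)" if b: "b \<in> C" for b
  proof -
    define \<sigma> where "\<sigma> = transpose a b"
    define h where "h v = (\<lambda>k. if k \<in> {1..n} then \<sigma> (v k) else undefined)" for v :: "nat \<Rightarrow> 'a"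
    have \<sigma>: "\<sigma> (\<sigma> c) = c" "\<sigma> a = b" "\<sigma> b = a" "inj \<sigma>" for c
      by (simp_all add: \<sigma>_def)
    have \<sigma>C: "\<sigma> c \<in> C" if "c \<in> C" for c
      using that a b by (simp add: \<sigma>_def transpose_def)
    have hC: "h v \<in> configs C n" if "v \<in> configs C n" for v
      by (rule configsI) (auto simp: h_def intro!: \<sigma>C configs_in_colors[OF that])
    have hh: "h (h v) = v" if "v \<in> configs C n" for v
      by (rule configs_eqI[OF hC[OF hC[OF that]] that]) (simp add: h_def \<sigma>)
    have hw: "ising_weight n T (h v) = ising_weight n T v" for v
    proof -
      have "chain_weight T (h v) 1 n = chain_weight T (\<lambda>k. \<sigma> (v k)) 1 n"
        by (rule chain_weight_cong) (auto simp: h_def)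
      then show ?thesis by (simp add: ising_weight_eq_chain_weight chain_weight_map \<sigma>)
    qed
    show ?thesis
      by (rule sum.reindex_bij_witness[of _ h h]) (use i hC hh hw \<sigma> in \<open>auto simp: h_def\<close>)
  qed
  have "partition_fn C n T = (\<Sum>b\<in>C. \<Sum>v | v \<in> configs C n \<and> v i = b. ising_weight n T v)"
    unfolding partition_fn_def
    using sum.group[OF finite_configs[OF C] C, of "\<lambda>v. v i" n "ising_weight n T"]
      configs_in_colors[OF _ i] by force
  also have "\<dots> = (\<Sum>b\<in>C. \<Sum>v | v \<in> configs C n \<and> v i = a. ising_weight n T v)"
    by (intro sum.cong refl eq)
  finally show ?thesis by simp
qed

text \<open>The canonical path from \<open>x\<close> to \<open>y\<close> rewrites the sites from left to right; \<open>splice i y x\<close> is its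
  position after \<open>i\<close> steps.\<close>

definition splice :: "nat \<Rightarrow> (nat \<Rightarrow> 'c) \<Rightarrow> (nat \<Rightarrow> 'c) \<Rightarrow> nat \<Rightarrow> 'c" where
  "splice i y x k = (if k \<le> i then y k else x k)"

lemma splice_in_configs: "x \<in> configs C n \<Longrightarrow> y \<in> configs C n \<Longrightarrow> splice i y x \<in> configs C n"
  by (rule configsI) (auto simp: splice_def configs_in_colors configs_outside)

lemma splice_step: "1 \<le> i \<Longrightarrow> splice i y x = (splice (i - 1) y x)(i := y i)"
  by (auto simp: splice_def fun_eq_iff)

lemma splice_0: "x \<in> configs C n \<Longrightarrow> y \<in> configs C n \<Longrightarrow> splice 0 y x = x"
  by (rule configs_eqI[OF splice_in_configs]) (auto simp: splice_def)

lemma splice_full: "x \<in> configs C n \<Longrightarrow> y \<in> configs C n \<Longrightarrow> splice n y x = y"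
  by (rule configs_eqI[OF splice_in_configs]) (auto simp: splice_def)

lemma path_telescope:
  fixes f :: "(nat \<Rightarrow> 'c) \<Rightarrow> real"
  assumes "x \<in> configs C n" "y \<in> configs C n"
  shows "f y - f x = (\<Sum>i\<in>{1..n}. f (splice i y x) - f (splice (i - 1) y x))"
  using sum_telescope''[of 0 n "\<lambda>i. f (splice i y x)"] splice_0[OF assms] splice_full[OF assms]
  by simp

text \<open>The total flow through the edges of the canonical paths at site \<open>i\<close>. Cut \<open>x\<close> and \<open>y\<close> before
  site \<open>i\<close> and join them crosswise. One product is the starting point \<open>z\<close> of the edge. The other one
  consists of the left part of \<open>x\<close> and the right part of \<open>y\<close>; exchanging the colors \<open>x i\<close> and \<open>y i\<close>
  from site \<open>i\<close> on gives a configuration \<open>v\<close> with \<open>v i = z i\<close> whose left bond is that of \<open>x\<close> and whose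
  right bonds have the weights of \<open>y\<close>. The pair \<open>(x, y)\<close> can be recovered from \<open>z\<close>, \<open>v\<close> and the new
  color \<open>c = y i\<close>, and the product of the two weights changes only at the
  bond to the left of \<open>i\<close>, which crosses the cut. The sum over \<open>v\<close> is then known by symmetry.\<close>

lemma path_congestion:
  assumes C: "finite C" and i: "i \<in> {1..n}"
  shows "real (card C) * (\<Sum>x\<in>configs C n. \<Sum>y\<in>configs C n.
      ising_weight n T x * ising_weight n T y * F (splice (i - 1) y x) (y i)) =
    partition_fn C n T * (\<Sum>z\<in>configs C n. \<Sum>c\<in>C.
      ising_weight n T z * (left_factor T z i c / left_factor T z i (z i)) * F z c)"
proof -
  let ?S = "configs C n" and ?w = "ising_weight n T"
  let ?L = "\<lambda>z c. left_factor T z i c / left_factor T z i (z i)"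
  define fwd where "fwd = (\<lambda>(x, y). (splice (i - 1) y x, y i,
     \<lambda>k. if k \<in> {1..n} then if k \<le> i then x k else transpose (x i) (y i) (y k)
       else undefined :: 'a))"
  define bwd where "bwd = (\<lambda>(z, c, v). (splice (i - 1) v z,
     \<lambda>k. if k \<in> {1..n} then if k < i then z k else if k = i then c else transpose (z i) c (v k)
       else undefined :: 'a))"
  define R where "R = (SIGMA z:?S. SIGMA c:C. {v\<in>?S. v i = z i})"
  have trC: "transpose a b c \<in> C" if "a \<in> C" "b \<in> C" "c \<in> C" for a b c
    using that by (simp add: transpose_def)
  have "(\<Sum>x\<in>?S. \<Sum>y\<in>?S. ?w x * ?w y * F (splice (i - 1) y x) (y i)) =
    (\<Sum>(x, y)\<in>?S \<times> ?S. ?w x * ?w y * F (splice (i - 1) y x) (y i))"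
    by (rule sum.cartesian_product)
  also have "\<dots> = (\<Sum>(z, c, v)\<in>R. ?w z * ?L z c * F z c * ?w v)"
  proof (rule sum.reindex_bij_witness[of _ bwd fwd])
    fix p assume "p \<in> ?S \<times> ?S"
    then obtain x y where p: "p = (x, y)" and x: "x \<in> ?S" and y: "y \<in> ?S" by auto
    note xC = configs_in_colors[OF x] and yC = configs_in_colors[OF y]
    obtain z c v where f: "fwd p = (z, c, v)" by (metis prod_cases3)
    then have z_def: "z = splice (i - 1) y x" and c_def: "c = y i"
      and v_def: "v = (\<lambda>k. if k \<in> {1..n} then if k \<le> i then x k
          else transpose (x i) (y i) (y k) else undefined)"
      by (simp_all add: fwd_def p)
    have z: "z \<in> ?S" unfolding z_def by (rule splice_in_configs[OF x y])
    have v: "v \<in> ?S"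
      by (rule configsI) (use i in \<open>auto simp: v_def xC yC trC\<close>)
    have zi: "z i = x i" and vi: "v i = x i" using i by (auto simp: z_def v_def splice_def)
    show "fwd p \<in> R" unfolding f R_def using z v zi vi i yC by (auto simp: c_def)
    show "bwd (fwd p) = p"
    proof -
      have a: "splice (i - 1) v z = x"
        by (rule configs_eqI[OF splice_in_configs[OF z v] x])
          (auto simp: splice_def z_def v_def)
      have b: "(\<lambda>k. if k \<in> {1..n} then if k < i then z k else if k = i then c
          else transpose (z i) c (v k) else undefined) = y"
        using zi configs_outside[OF y] by (auto simp: fun_eq_iff z_def splice_def v_def c_def)
      show ?thesis unfolding f bwd_def prod.case unfolding a b by (rule p[symmetric])
    qed
    have 1: "chain_weight T z 1 (i - 1) = chain_weight T y 1 (i - 1)"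
      by (rule chain_weight_cong) (auto simp: z_def splice_def)
    have 2: "chain_weight T z (Suc i) n = chain_weight T x (Suc i) n"
      by (rule chain_weight_cong) (auto simp: z_def splice_def)
    have 3: "chain_weight T v 1 (i - 1) = chain_weight T x 1 (i - 1)"
      by (rule chain_weight_cong) (use i in \<open>auto simp: v_def\<close>)
    have 4: "chain_weight T v (Suc i) n = chain_weight T y (Suc i) n"
    proof -
      have "chain_weight T v (Suc i) n = chain_weight T (\<lambda>k. transpose (x i) (y i) (y k)) (Suc i) n"
        by (rule chain_weight_cong) (auto simp: v_def)
      then show ?thesis by (simp add: chain_weight_map)
    qed
    have 5: "left_factor T z i d = left_factor T y i d" for d
      by (auto simp: left_factor_def z_def splice_def)
    have 6: "right_factor n T z i d = right_factor n T x i d" for d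
      by (rule right_factor_cong) (auto simp: z_def splice_def)
    have 7: "left_factor T v i d = left_factor T x i d" for d
      using i by (auto simp: left_factor_def v_def)
    have 8: "right_factor n T v i (x i) = right_factor n T y i (y i)"
    proof (cases "i = n")
      case False
      have "v (i + 1) = transpose (x i) (y i) (y (i + 1))" using False i by (simp add: v_def)
      moreover have "x i = transpose (x i) (y i) d \<longleftrightarrow> y i = d" for d
        by (metis transpose_apply_first transpose_apply_second transpose_involutory)
      ultimately have "x i = v (i + 1) \<longleftrightarrow> y i = y (i + 1)" by (simp only:)
      with False show ?thesis by (simp only: right_factor_def bond_weight_def if_False)
    qed (simp add: right_factor_def)
    have "?w z * ?L z c * ?w v = ?w x * ?w y"
      unfolding ising_weight_factorization[OF i] zi vi 1 2 3 4 5 6 7 8 c_def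
      using left_factor_pos[of T y i "x i"] by simp
    moreover have "?w z * ?L z c * F z c * ?w v = (?w z * ?L z c * ?w v) * F z c"
      by (simp only: ac_simps)
    ultimately have eq: "?w z * ?L z c * F z c * ?w v = ?w x * ?w y * F z c" by (simp only:)
    show "(case fwd p of (z, c, v) \<Rightarrow> ?w z * ?L z c * F z c * ?w v) =
      (case p of (x, y) \<Rightarrow> ?w x * ?w y * F (splice (i - 1) y x) (y i))"
      unfolding f unfolding p prod.case z_def[symmetric] c_def[symmetric] by (rule eq)
  next
    fix r assume "r \<in> R"
    then obtain z c v where r: "r = (z, c, v)" and z: "z \<in> ?S" and c: "c \<in> C" and v: "v \<in> ?S"
      and vi: "v i = z i" by (auto simp: R_def)
    note zC = configs_in_colors[OF z] and vC = configs_in_colors[OF v]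
    obtain x y where b: "bwd r = (x, y)" by (metis surj_pair)
    then have x_def: "x = splice (i - 1) v z"
      and y_def: "y = (\<lambda>k. if k \<in> {1..n} then if k < i then z k else if k = i then c
          else transpose (z i) c (v k) else undefined)"
      by (simp_all add: bwd_def r)
    have x: "x \<in> ?S" unfolding x_def by (rule splice_in_configs[OF z v])
    have y: "y \<in> ?S"
      by (rule configsI) (use i c in \<open>auto simp: y_def zC vC trC\<close>)
    show "bwd r \<in> ?S \<times> ?S" using x y by (simp add: b)
    have xi: "x i = z i" and yi: "y i = c" using i by (auto simp: x_def y_def splice_def)
    have a: "splice (i - 1) y x = z"
      by (rule configs_eqI[OF splice_in_configs[OF x y] z]) (auto simp: splice_def x_def y_def)
    have b': "(\<lambda>k. if k \<in> {1..n} then if k \<le> i then x k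
          else transpose (x i) (y i) (y k) else undefined) = v"
      unfolding xi yi using vi configs_outside[OF v]
    proof (intro ext)
      fix k
      consider "k < i" | "k = i" | "i < k" by linarith
      then show "(if k \<in> {1..n} then if k \<le> i then x k else transpose (z i) c (y k)
          else undefined) = v k"
        by cases (use i vi configs_outside[OF v, of k] in \<open>auto simp: x_def y_def splice_def\<close>)
    qed
    show "fwd (bwd r) = r" unfolding b fwd_def prod.case unfolding b' unfolding a yi by (rule r[symmetric])
  qed
  also have "\<dots> = (\<Sum>z\<in>?S. \<Sum>c\<in>C. \<Sum>v | v \<in> ?S \<and> v i = z i. ?w z * ?L z c * F z c * ?w v)"
    unfolding R_def using C by (simp add: finite_configs sum.Sigma)
  also have "real (card C) * \<dots> = (\<Sum>z\<in>?S. \<Sum>c\<in>C. ?w z * ?L z c * F z c *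
      (real (card C) * (\<Sum>v | v \<in> ?S \<and> v i = z i. ?w v)))"
    by (simp add: sum_distrib_left mult_ac)
  also have "\<dots> = (\<Sum>z\<in>?S. \<Sum>c\<in>C. ?w z * ?L z c * F z c * partition_fn C n T)"
    using card_times_sum_color_fixed[OF C i configs_in_colors[OF _ i]] by simp
  finally show ?thesis by (simp add: sum_distrib_left mult_ac)
qed

section \<open>Comparison of single-site factors\<close>

text \<open>A bond weight exceeds another one by a factor of at most \<open>exp (2 / T)\<close>, and only if its color is
  the one at the other end of the bond. The bound \<open>exp (4 / T) + (card C - 1)\<close> is the inverse of
  the conditional probability of a color that differs from the common color of two agreeing
  neighbors.\<close>

lemma sum_factor_ratio_squares_le:
  assumes C: "finite C" and a: "a \<in> C"
    and \<rho>: "\<And>d. \<bar>\<rho> d\<bar> \<le> (if d = a then exp (2 / T) else 1)"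
  shows "(\<Sum>d\<in>C. (\<rho> d)\<^sup>2) \<le> exp (4 / T) + (real (card C) - 1)"
proof -
  have "(\<Sum>d\<in>C. (\<rho> d)\<^sup>2) \<le> (\<Sum>d\<in>C. (if d = a then exp (2 / T) else 1)\<^sup>2)"
  proof (rule sum_mono)
    fix d
    have "\<bar>\<rho> d\<bar>\<^sup>2 \<le> (if d = a then exp (2 / T) else 1)\<^sup>2" by (intro power_mono \<rho>) simp
    then show "(\<rho> d)\<^sup>2 \<le> (if d = a then exp (2 / T) else 1)\<^sup>2" by simp
  qed
  also have "\<dots> = (exp (2 / T))\<^sup>2 + (\<Sum>d\<in>C - {a}. 1)"
    by (subst sum.remove[OF C a]) simp
  also have "(exp (2 / T))\<^sup>2 = exp (4 / T)" by (simp add: exp_double[symmetric])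
  also have "(\<Sum>d\<in>C - {a}. 1) = real (card C) - 1"
    using C a card_gt_0_iff[of C] by (auto simp: of_nat_diff Suc_le_eq)
  finally show ?thesis .
qed

lemma bond_weight_ratio_le:
  assumes "T > 0"
  shows "bond_weight T a d / bond_weight T a u \<le> (if d = a then exp (2 / T) else 1)"
    and "bond_weight T d a / bond_weight T u a \<le> (if d = a then exp (2 / T) else 1)"
proof -
  have sym: "bond_weight T b c = bond_weight T c b" for b c :: 'a
    by (simp add: bond_weight_def eq_commute)
  let ?s = "\<lambda>d. of_bool (a = d) - of_bool (a \<noteq> d) :: real"
  have "bond_weight T a d / bond_weight T a u = exp ((?s d - ?s u) / T)"
    by (simp only: bond_weight_def diff_divide_distrib exp_diff)
  also have "\<dots> \<le> exp ((if d = a then 2 else 0) / T)"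
    unfolding exp_le_cancel_iff using assms by (intro divide_right_mono) (auto split: if_splits)
  finally show "bond_weight T a d / bond_weight T a u \<le> (if d = a then exp (2 / T) else 1)"
    by (simp split: if_splits)
  then show "bond_weight T d a / bond_weight T u a \<le> (if d = a then exp (2 / T) else 1)"
    unfolding sym[of d a] sym[of u a] .
qed

text \<open>By the inequality between arithmetic and geometric mean the sum of the products of the two
  normalized factors is at most the mean of the two sums of squares, each of which involves a single
  bond. This treats agreeing and disagreeing neighbors alike.\<close>

lemma sum_site_factors_le:
  assumes C: "finite C" and T: "T > 0" and i: "i \<in> {1..n}" and z: "z \<in> configs C n"
  shows "(\<Sum>d\<in>C. left_factor T z i d * right_factor n T z i d) \<le>
    (exp (4 / T) + (real (card C) - 1)) * (left_factor T z i u * right_factor n T z i v)"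
proof -
  let ?M = "exp (4 / T) + (real (card C) - 1)"
  define \<alpha> where "\<alpha> d = left_factor T z i d / left_factor T z i u" for d
  define \<rho> where "\<rho> d = right_factor n T z i d / right_factor n T z i v" for d
  have T': "1 \<le> exp (2 / T)" using T by simp
  have nonneg: "0 \<le> \<alpha> d" "0 \<le> \<rho> d" for d
    unfolding \<alpha>_def \<rho>_def
    by (intro divide_nonneg_pos less_imp_le[OF left_factor_pos] left_factor_pos
        less_imp_le[OF right_factor_pos] right_factor_pos)+
  \<comment> \<open>The distinguished color is that of the neighbor. At an end of the chain the factor is constant,
    and the color at \<open>i\<close> itself is an arbitrary choice.\<close>
  have "(\<Sum>d\<in>C. (\<alpha> d)\<^sup>2) \<le> ?M"
  proof (rule sum_factor_ratio_squares_le[OF C])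
    show "z (if i = 1 then i else i - 1) \<in> C" using i by (intro configs_in_colors[OF z]) auto
    show "\<bar>\<alpha> d\<bar> \<le> (if d = z (if i = 1 then i else i - 1) then exp (2 / T) else 1)" for d
      using nonneg bond_weight_ratio_le(1)[OF T, of "z (i - 1)" d u] T'
      by (auto simp: \<alpha>_def left_factor_def abs_of_pos[OF bond_weight_pos])
  qed
  moreover have "(\<Sum>d\<in>C. (\<rho> d)\<^sup>2) \<le> ?M"
  proof (rule sum_factor_ratio_squares_le[OF C])
    show "z (if i = n then i else i + 1) \<in> C" using i by (intro configs_in_colors[OF z]) auto
    show "\<bar>\<rho> d\<bar> \<le> (if d = z (if i = n then i else i + 1) then exp (2 / T) else 1)" for d
      using nonneg bond_weight_ratio_le(2)[OF T, where a = "z (i + 1)" and d = d and u = v] T'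
      by (auto simp: \<rho>_def right_factor_def abs_of_pos[OF bond_weight_pos])
  qed
  moreover have "(\<Sum>d\<in>C. \<alpha> d * \<rho> d) \<le> (\<Sum>d\<in>C. ((\<alpha> d)\<^sup>2 + (\<rho> d)\<^sup>2) / 2)"
    by (intro sum_mono) (use sum_squares_bound in \<open>simp add: field_simps\<close>)
  ultimately have le: "(\<Sum>d\<in>C. \<alpha> d * \<rho> d) \<le> ?M"
    by (simp add: sum.distrib flip: sum_divide_distrib)
  have "(\<Sum>d\<in>C. left_factor T z i d * right_factor n T z i d) =
      (\<Sum>d\<in>C. \<alpha> d * \<rho> d) * (left_factor T z i u * right_factor n T z i v)"
    using left_factor_pos[of T z i u] right_factor_pos[of n T z i v]
    by (simp add: sum_distrib_right \<alpha>_def \<rho>_def)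
  also have "\<dots> \<le> ?M * (left_factor T z i u * right_factor n T z i v)"
    using le left_factor_pos[of T z i u] right_factor_pos[of n T z i v]
    by (intro mult_right_mono) auto
  finally show ?thesis .
qed

lemma ising_cond_eq_factors:
  assumes "finite C" "C \<noteq> {}" "i \<in> {1..n}"
  shows "ising_cond C n T i c z = left_factor T z i c * right_factor n T z i c /
    (\<Sum>d\<in>C. left_factor T z i d * right_factor n T z i d)"
proof -
  define A where "A = chain_weight T z 1 (i - 1) * chain_weight T z (Suc i) n"
  have A: "A > 0" by (simp add: A_def chain_weight_pos)
  have "ising_weight n T (z(i := d)) = A * (left_factor T z i d * right_factor n T z i d)" for d
    unfolding ising_weight_update[OF assms(3)] A_def by (simp only: ac_simps)
  then show ?thesis using A by (simp add: ising_cond_eq[OF assms(1,2)] flip: sum_distrib_left)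
qed

text \<open>The flow found in \<open>path_congestion\<close> carries the ratio of two left factors, while an edge of the
  Dirichlet form carries a conditional probability. The bound assumed on the normalizing sum of that
  probability compares the two edge by edge.\<close>

lemma path_energy_le_dirichlet:
  fixes f :: "(nat \<Rightarrow> 'c) \<Rightarrow> real"
  assumes C: "finite C" "C \<noteq> {}" and i: "i \<in> {1..n}"
    and M: "\<And>z u v. z \<in> configs C n \<Longrightarrow> (\<Sum>d\<in>C. left_factor T z i d * right_factor n T z i d) \<le>
      M * (left_factor T z i u * right_factor n T z i v)"
  shows "real (card C) * (\<Sum>x\<in>configs C n. \<Sum>y\<in>configs C n.
      ising_weight n T x * ising_weight n T y * (f (splice i y x) - f (splice (i - 1) y x))\<^sup>2) \<le>
    partition_fn C n T * (M * (\<Sum>z\<in>configs C n. \<Sum>c\<in>C.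
      ising_weight n T z * ising_cond C n T i c z * (f (z(i := c)) - f z)\<^sup>2))"
proof -
  have "(\<Sum>z\<in>configs C n. \<Sum>c\<in>C. ising_weight n T z *
      (left_factor T z i c / left_factor T z i (z i)) * (f (z(i := c)) - f z)\<^sup>2) \<le>
    (\<Sum>z\<in>configs C n. \<Sum>c\<in>C. ising_weight n T z * (M * ising_cond C n T i c z) *
      (f (z(i := c)) - f z)\<^sup>2)"
  proof (intro sum_mono mult_right_mono mult_left_mono)
    fix z c assume z: "z \<in> configs C n"
    let ?L = "left_factor T z i" and ?R = "right_factor n T z i"
    have s: "0 < (\<Sum>d\<in>C. ?L d * ?R d)"
      using C by (intro sum_pos mult_pos_pos left_factor_pos right_factor_pos)
    have "(\<Sum>d\<in>C. ?L d * ?R d) * ?L c \<le> M * (?L (z i) * ?R c) * ?L c"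
      by (intro mult_right_mono M z less_imp_le[OF left_factor_pos])
    then have "?L c / ?L (z i) \<le> M * (?L c * ?R c) / (\<Sum>d\<in>C. ?L d * ?R d)"
      using s left_factor_pos[of T z i "z i"] by (simp add: divide_simps mult_ac)
    then show "?L c / ?L (z i) \<le> M * ising_cond C n T i c z"
      by (simp add: ising_cond_eq_factors[OF C i])
  qed (auto simp: less_imp_le[OF ising_weight_pos])
  also have "\<dots> = M * (\<Sum>z\<in>configs C n. \<Sum>c\<in>C.
      ising_weight n T z * ising_cond C n T i c z * (f (z(i := c)) - f z)\<^sup>2)"
    unfolding sum_distrib_left by (intro sum.cong refl) (simp only: ac_simps)
  finally have le: "partition_fn C n T * (\<Sum>z\<in>configs C n. \<Sum>c\<in>C. ising_weight n T z *
      (left_factor T z i c / left_factor T z i (z i)) * (f (z(i := c)) - f z)\<^sup>2) \<le>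
    partition_fn C n T * (M * (\<Sum>z\<in>configs C n. \<Sum>c\<in>C.
      ising_weight n T z * ising_cond C n T i c z * (f (z(i := c)) - f z)\<^sup>2))"
    by (intro mult_left_mono less_imp_le[OF partition_fn_pos[OF C]])
  have "splice i y x = (splice (i - 1) y x)(i := y i)" for x y :: "nat \<Rightarrow> 'c"
    using i by (intro splice_step) auto
  then show ?thesis
    using le path_congestion[OF C(1) i, of T "\<lambda>z c. (f (z(i := c)) - f z)\<^sup>2"] by (simp only:)
qed

section \<open>Poincare inequality and second eigenvalue\<close>

lemma increment_square_le_path_energy:
  fixes f :: "(nat \<Rightarrow> 'c) \<Rightarrow> real"
  assumes "x \<in> configs C n" "y \<in> configs C n"
  shows "(f x - f y)\<^sup>2 \<le> real n * (\<Sum>i\<in>{1..n}. (f (splice i y x) - f (splice (i - 1) y x))\<^sup>2)"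
proof -
  have "(f x - f y)\<^sup>2 = (f y - f x)\<^sup>2" by (rule power2_commute)
  also have "\<dots> \<le> (\<Sum>i\<in>{1..n}. (f (splice i y x) - f (splice (i - 1) y x))\<^sup>2) * card {1..n}"
    unfolding path_telescope[OF assms] by (rule sum_squared_le_sum_of_squares)
  finally show ?thesis by (simp add: mult.commute)
qed

lemma nonconstant_single_site:
  fixes f :: "(nat \<Rightarrow> 'c) \<Rightarrow> real"
  assumes "x \<in> configs C n" "y \<in> configs C n" "f x \<noteq> f y"
  obtains z i c where "z \<in> configs C n" "i \<in> {1..n}" "c \<in> C" "f (z(i := c)) \<noteq> f z"
proof -
  have "\<exists>i\<in>{1..n}. f (splice i y x) \<noteq> f (splice (i - 1) y x)"
  proof (rule ccontr)
    assume "\<not> ?thesis"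
    then have "f y - f x = 0" unfolding path_telescope[OF assms(1,2)] by (intro sum.neutral) auto
    with assms(3) show False by simp
  qed
  then obtain i where i: "i \<in> {1..n}" "f (splice i y x) \<noteq> f (splice (i - 1) y x)" by blast
  show thesis
    by (rule that[OF splice_in_configs[OF assms(1,2), of "i - 1"] i(1)
          configs_in_colors[OF assms(2) i(1)]])
      (use i splice_step[of i y x] in auto)
qed

text \<open>The Cauchy-Schwarz bound along a path is strict if only one of its steps changes \<open>f\<close> and the path
  has at least two steps. This happens for \<open>z\<close> and a configuration obtained from it by a change of one
  site that changes \<open>f\<close>.\<close>

lemma variance_less_path_energy:
  fixes f :: "(nat \<Rightarrow> 'c) \<Rightarrow> real"
  assumes C: "finite C" and n: "2 \<le> n" and nc: "\<exists>x\<in>configs C n. \<exists>y\<in>configs C n. f x \<noteq> f y"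
  shows "(\<Sum>x\<in>configs C n. \<Sum>y\<in>configs C n. ising_weight n T x * ising_weight n T y * (f x - f y)\<^sup>2) <
    (\<Sum>x\<in>configs C n. \<Sum>y\<in>configs C n. ising_weight n T x * ising_weight n T y *
      (real n * (\<Sum>i\<in>{1..n}. (f (splice i y x) - f (splice (i - 1) y x))\<^sup>2)))"
    (is "(\<Sum>x\<in>?S. \<Sum>y\<in>?S. ?l x y) < (\<Sum>x\<in>?S. \<Sum>y\<in>?S. ?r x y)")
proof -
  note fin = finite_configs[OF C, of n]
  have le: "?l x y \<le> ?r x y" if "x \<in> ?S" "y \<in> ?S" for x y
    by (intro mult_left_mono increment_square_le_path_energy[OF that])
      (simp add: less_imp_le ising_weight_pos)
  obtain z i c where z: "z \<in> ?S" and i: "i \<in> {1..n}" and c: "c \<in> C" and ne: "f (z(i := c)) \<noteq> f z"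
  proof -
    obtain x y where "x \<in> ?S" "y \<in> ?S" "f x \<noteq> f y" using nc by blast
    then show thesis using that by (rule nonconstant_single_site)
  qed
  define y where "y = z(i := c)"
  have y: "y \<in> ?S" unfolding y_def by (rule configs_update[OF z i c])
  have sp: "splice i y z = y" "splice (i - 1) y z = z"
    using i by (auto simp: splice_def y_def fun_eq_iff)
  have "(f z - f y)\<^sup>2 < real n * (f y - f z)\<^sup>2"
    using n ne by (simp add: y_def power2_commute[of "f z"])
  also have "\<dots> \<le> real n * (\<Sum>i\<in>{1..n}. (f (splice i y z) - f (splice (i - 1) y z))\<^sup>2)"
  proof (rule mult_left_mono)
    have "(f (splice i y z) - f (splice (i - 1) y z))\<^sup>2 \<le>
      (\<Sum>i\<in>{1..n}. (f (splice i y z) - f (splice (i - 1) y z))\<^sup>2)"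
      by (rule member_le_sum[OF i]) auto
    then show "(f y - f z)\<^sup>2 \<le> (\<Sum>i\<in>{1..n}. (f (splice i y z) - f (splice (i - 1) y z))\<^sup>2)"
      unfolding sp .
  qed simp
  finally have lt: "?l z y < ?r z y"
    by (intro mult_strict_left_mono mult_pos_pos ising_weight_pos)
  show ?thesis
  proof (rule sum_strict_mono_ex1[OF fin])
    show "\<forall>x\<in>?S. (\<Sum>y\<in>?S. ?l x y) \<le> (\<Sum>y\<in>?S. ?r x y)"
      by (intro ballI sum_mono le)
    show "\<exists>x\<in>?S. (\<Sum>y\<in>?S. ?l x y) < (\<Sum>y\<in>?S. ?r x y)"
    proof
      show "(\<Sum>y\<in>?S. ?l z y) < (\<Sum>y\<in>?S. ?r z y)"
        by (rule sum_strict_mono_ex1[OF fin]) (use le[OF z] lt y in blast)+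
    qed (rule z)
  qed
qed

lemma weighted_double_sum_swap:
  fixes w :: "'s \<Rightarrow> real"
  shows "(\<Sum>x\<in>S. \<Sum>y\<in>S. w x * w y * (a * (\<Sum>i\<in>I. h i x y))) =
    a * (\<Sum>i\<in>I. \<Sum>x\<in>S. \<Sum>y\<in>S. w x * w y * h i x y)"
proof -
  have "(\<Sum>i\<in>I. \<Sum>x\<in>S. \<Sum>y\<in>S. w x * w y * h i x y) =
      (\<Sum>x\<in>S. \<Sum>y\<in>S. \<Sum>i\<in>I. w x * w y * h i x y)"
    by (subst sum.swap, rule sum.cong[OF refl], rule sum.swap)
  also have "\<dots> = (\<Sum>x\<in>S. \<Sum>y\<in>S. w x * w y * (\<Sum>i\<in>I. h i x y))"
    by (simp only: sum_distrib_left)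
  finally show ?thesis by (simp add: sum_distrib_left mult.left_commute)
qed

text \<open>Summing the edge comparison over all sites gives the inequality. For \<open>n \<ge> 2\<close> it is strict since
  the Cauchy-Schwarz bound is; for \<open>n = 1\<close> there are no bonds, and the constant \<open>M\<close> can be replaced
  by the smaller number of colors.\<close>

lemma ising_poincare:
  fixes f :: "(nat \<Rightarrow> 'c) \<Rightarrow> real"
  assumes C: "finite C" "C \<noteq> {}" and n: "1 \<le> n" and T: "T > 0"
    and nc: "\<exists>x\<in>configs C n. \<exists>y\<in>configs C n. f x \<noteq> f y"
  shows "real (card C) / (real n)\<^sup>2 / (exp (4 / T) + (real (card C) - 1)) *
      (\<Sum>x\<in>configs C n. \<Sum>y\<in>configs C n.
        ising_weight n T x * ising_weight n T y * (f x - f y)\<^sup>2) <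
    partition_fn C n T * (\<Sum>x\<in>configs C n. \<Sum>y\<in>configs C n.
      ising_weight n T x * gibbs_kernel C n T x y * (f x - f y)\<^sup>2)"
proof -
  let ?S = "configs C n" and ?w = "ising_weight n T" and ?N = "real (card C)"
  define M where "M = exp (4 / T) + (?N - 1)"
  define V where "V = (\<Sum>x\<in>?S. \<Sum>y\<in>?S. ?w x * ?w y * (f x - f y)\<^sup>2)"
  define E where "E i = (\<Sum>x\<in>?S. \<Sum>y\<in>?S. ?w x * ?w y *
    (f (splice i y x) - f (splice (i - 1) y x))\<^sup>2)" for i
  define G where "G i = (\<Sum>z\<in>?S. \<Sum>c\<in>C.
    ?w z * ising_cond C n T i c z * (f (z(i := c)) - f z)\<^sup>2)" for i
  define D where "D = (\<Sum>i\<in>{1..n}. G i)"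
  have fin: "finite ?S" by (rule finite_configs[OF C(1)])
  have N: "?N > 0" using C by (simp add: card_gt_0_iff)
  have MN: "?N < M" using T by (simp add: M_def)
  have Z: "partition_fn C n T > 0" by (rule partition_fn_pos[OF C])
  have dir: "(\<Sum>x\<in>?S. \<Sum>y\<in>?S. ?w x * gibbs_kernel C n T x y * (f x - f y)\<^sup>2) = D / real n"
    unfolding gibbs_dirichlet_form[OF C(1)] D_def G_def by (simp only: times_divide_eq_left mult_1_left)
  have path: "(\<Sum>x\<in>?S. \<Sum>y\<in>?S. ?w x * ?w y *
      (real n * (\<Sum>i\<in>{1..n}. (f (splice i y x) - f (splice (i - 1) y x))\<^sup>2))) =
    real n * (\<Sum>i\<in>{1..n}. E i)"
    unfolding E_def by (rule weighted_double_sum_swap)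
  have energy: "?N * (\<Sum>i\<in>{1..n}. E i) \<le> partition_fn C n T * (M' * D)"
    if M': "\<And>i z u v. i \<in> {1..n} \<Longrightarrow> z \<in> ?S \<Longrightarrow>
      (\<Sum>d\<in>C. left_factor T z i d * right_factor n T z i d) \<le>
      M' * (left_factor T z i u * right_factor n T z i v)" for M'
  proof -
    have "?N * (\<Sum>i\<in>{1..n}. E i) = (\<Sum>i\<in>{1..n}. ?N * E i)" by (rule sum_distrib_left)
    also have "\<dots> \<le> (\<Sum>i\<in>{1..n}. partition_fn C n T * (M' * G i))"
    proof (rule sum_mono)
      fix i assume i: "i \<in> {1..n}"
      show "?N * E i \<le> partition_fn C n T * (M' * G i)"
        unfolding E_def G_def by (rule path_energy_le_dirichlet[OF C i M'[OF i]])
    qed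
    finally show ?thesis by (simp only: D_def sum_distrib_left)
  qed
  have "?N * V < real n * (partition_fn C n T * (M * D))"
  proof (cases "n = 1")
    case True
    have "0 < V"
    proof -
      obtain x y where xy: "x \<in> ?S" "y \<in> ?S" "f x \<noteq> f y" using nc by blast
      have "0 < (\<Sum>y\<in>?S. ?w x * ?w y * (f x - f y)\<^sup>2)"
        by (rule sum_pos2[OF fin xy(2)]) (use xy(3) in \<open>simp_all add: ising_weight_pos less_imp_le\<close>)
      then show ?thesis unfolding V_def
        by (rule sum_pos2[OF fin xy(1)]) (simp add: sum_nonneg ising_weight_pos less_imp_le)
    qed
    have "V \<le> real n * (\<Sum>i\<in>{1..n}. E i)"
      unfolding V_def path[symmetric]
      by (intro sum_mono mult_left_mono increment_square_le_path_energy)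
        (auto simp: less_imp_le ising_weight_pos)
    then have "?N * V \<le> ?N * (\<Sum>i\<in>{1..n}. E i)" using True N by simp
    also have "\<dots> \<le> partition_fn C n T * (?N * D)"
      
    proof (rule energy)
      fix i z u v assume "i \<in> {1..n}"
      then have "i = 1" using True by simp
      then show "(\<Sum>d\<in>C. left_factor T z i d * right_factor n T z i d) \<le>
          ?N * (left_factor T z i u * right_factor n T z i v)"
        using True by (simp add: left_factor_def right_factor_def)
    qed
    finally have le: "?N * V \<le> partition_fn C n T * (?N * D)" .
    have "0 < ?N * V" using N \<open>0 < V\<close> by (rule mult_pos_pos)
    then have "0 < partition_fn C n T * (?N * D)" using le by (rule less_le_trans)
    then have "0 < D" using Z N by (simp add: zero_less_mult_iff)
    then have "partition_fn C n T * (?N * D) < partition_fn C n T * (M * D)" using Z MN by simp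
    with le True show ?thesis by simp
  next
    case False
    then have "V < real n * (\<Sum>i\<in>{1..n}. E i)"
      unfolding V_def path[symmetric] using n by (intro variance_less_path_energy C nc) auto
    then have "?N * V < real n * (?N * (\<Sum>i\<in>{1..n}. E i))"
      using N by (simp add: mult.left_commute)
    also have "\<dots> \<le> real n * (partition_fn C n T * (M * D))"
    proof (rule mult_left_mono)
      show "?N * (\<Sum>i\<in>{1..n}. E i) \<le> partition_fn C n T * (M * D)"
        unfolding M_def by (rule energy) (rule sum_site_factors_le[OF C(1) T])
    qed simp
    finally show ?thesis .
  qed
  then have "?N * V / ((real n)\<^sup>2 * M) <
      real n * (partition_fn C n T * (M * D)) / ((real n)\<^sup>2 * M)"
    using n MN N by (intro divide_strict_right_mono) auto
  also have "\<dots> = partition_fn C n T * (D / real n)"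
    using n MN N by (simp add: power2_eq_square)
  finally have "?N / (real n)\<^sup>2 / M * V < partition_fn C n T * (D / real n)" by simp
  then show ?thesis unfolding dir V_def M_def .
qed

theorem theorem3:
  fixes C :: "'c set" and n N :: nat and T :: real
  assumes "finite C" and "card C = N" and "N \<ge> 2" and "n \<ge> 1" and "T > 0"
  shows "gibbs_beta C n T 1 <
    1 - real N / (real n)\<^sup>2 * (exp (- 4 / T) / (1 + (real N - 1) * exp (- 4 / T)))"
proof -
  have C: "finite C" "C \<noteq> {}" using assms by auto
  define g where "g = real (card C) / (real n)\<^sup>2 / (exp (4 / T) + (real (card C) - 1))"
  have "2 \<le> card (configs C n)"
  proof -
    have "N ^ 1 \<le> N ^ n" using assms by (intro power_increasing) auto
    then show ?thesis using assms by (simp add: configs_def card_PiE)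
  qed
  moreover have "0 \<le> g" using assms by (auto simp: g_def)
  moreover have "sum (ising_weight n T) (configs C n) = partition_fn C n T"
    by (simp add: partition_fn_def)
  ultimately have "gibbs_beta C n T 1 < 1 - g"
    unfolding gibbs_beta_def
  proof (intro second_eigenvalue_less[where \<mu> = "ising_weight n T"])
    fix f :: "(nat \<Rightarrow> 'c) \<Rightarrow> real"
    assume Z: "sum (ising_weight n T) (configs C n) = partition_fn C n T"
    assume nc: "\<exists>x\<in>configs C n. \<exists>y\<in>configs C n. f x \<noteq> f y"
    show "g * (\<Sum>x\<in>configs C n. \<Sum>y\<in>configs C n.
        ising_weight n T x * ising_weight n T y * (f x - f y)\<^sup>2) <
      sum (ising_weight n T) (configs C n) * (\<Sum>x\<in>configs C n. \<Sum>y\<in>configs C n.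
        ising_weight n T x * gibbs_kernel C n T x y * (f x - f y)\<^sup>2)"
      unfolding Z g_def by (rule ising_poincare[OF C assms(4,5) nc])
  qed (simp_all add: finite_configs C ising_weight_pos gibbs_kernel_stochastic gibbs_kernel_reversible)
  moreover have "exp (- 4 / T) / (1 + (real N - 1) * exp (- 4 / T)) =
      1 / (exp (4 / T) + (real N - 1))"
  proof -
    have e: "exp (- 4 / T) = 1 / exp (4 / T)" by (simp add: exp_minus inverse_eq_divide)
    have "1 + (real N - 1) * (1 / exp (4 / T)) = (exp (4 / T) + (real N - 1)) / exp (4 / T)"
      by (simp add: add_divide_distrib)
    then show ?thesis unfolding e by simp
  qed
  ultimately show ?thesis using assms(2) by (simp add: g_def)
qed
end
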